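(* Let $H$ be a separable infinite-dimensional complex Hilbert space. Every nilpotent operator $T\in L(H)$ has a non-trivial invariant subspace.
   Context: $L(H)$ is the set of bounded linear operators from $H$ to $H$. An operator $T$ is nilpotent if $T^n=0$ for some positive integer $n$. A non-trivial invariant subspace of $T$ is a closed linear subspace $M\subseteq H$ with $TM\subseteq M$, $M\neq\{0\}$ and $M\neq H$. *)

theory Defs
  imports "HOL-Analysis.Analysis"
begin

text \<open>
  HOL-Analysis has real inner product spaces only.  The real vector space structure, the norm and
  the topology come from the library classes; the first and the last assumption below force them to
  be the ones induced by the complex scalar multiplication and the complex inner product.
  The inner product is linear in its first argument.
\<close>

class complex_hilbert_space = real_normed_vector + complete_space +
  fixes scaleC :: "complex \<Rightarrow> 'a \<Rightarrow> 'a"  (infixr \<open>*\<^sub>C\<close> 75)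
    and cinner :: "'a \<Rightarrow> 'a \<Rightarrow> complex"
  assumes scaleR_scaleC: "scaleR r x = scaleC (complex_of_real r) x"
    and scaleC_add_right: "scaleC a (x + y) = scaleC a x + scaleC a y"
    and scaleC_add_left: "scaleC (a + b) x = scaleC a x + scaleC b x"
    and scaleC_scaleC: "scaleC a (scaleC b x) = scaleC (a * b) x"
    and scaleC_one: "scaleC 1 x = x"
    and cinner_commute: "cinner x y = cnj (cinner y x)"
    and cinner_add_left: "cinner (x + y) z = cinner x z + cinner y z"
    and cinner_scaleC_left: "cinner (scaleC a x) y = a * cinner x y"
    and cinner_ge_zero: "0 \<le> Re (cinner x x)"
    and cinner_eq_zero_iff: "cinner x x = 0 \<longleftrightarrow> x = 0"
    and norm_eq_sqrt_cinner: "norm x = sqrt (Re (cinner x x))"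

global_interpretation complex_vector:
  vector_space "scaleC :: complex \<Rightarrow> 'a \<Rightarrow> 'a::complex_hilbert_space"
  defines csubspace = complex_vector.subspace
    and cspan = complex_vector.span
  by unfold_locales
    (auto simp: scaleC_add_right scaleC_add_left scaleC_scaleC scaleC_one)

definition cfinite_dimensional :: "'a::complex_hilbert_space itself \<Rightarrow> bool" where
  "cfinite_dimensional _ \<longleftrightarrow> (\<exists>B::'a set. finite B \<and> cspan B = UNIV)"

text \<open>\<open>bounded_linear\<close> is the library's boundedness, with linearity over the reals only.\<close>

definition bounded_clinear ::
    "('a::complex_hilbert_space \<Rightarrow> 'b::complex_hilbert_space) \<Rightarrow> bool" where
  "bounded_clinear T \<longleftrightarrow> bounded_linear T \<and> Vector_Spaces.linear scaleC scaleC T"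

definition nilpotent_operator :: "('a::complex_hilbert_space \<Rightarrow> 'a) \<Rightarrow> bool" where
  "nilpotent_operator T \<longleftrightarrow> (\<exists>n>0. T ^^ n = (\<lambda>x. 0))"

definition nontrivial_invariant_subspace ::
    "('a::complex_hilbert_space \<Rightarrow> 'a) \<Rightarrow> 'a set \<Rightarrow> bool" where
  "nontrivial_invariant_subspace T M \<longleftrightarrow>
     csubspace M \<and> closed M \<and> T ` M \<subseteq> M \<and> M \<noteq> {0} \<and> M \<noteq> UNIV"

end

theory Submission
  imports Defs
begin

text \<open>
  The subspace is the kernel of the operator whenever this is possible. The kernel of a nilpotent
  \<open>T\<close> is not zero: otherwise \<open>T\<close> and all its powers would be injective, while some power is zero.
  If the kernel is the whole space, then \<open>T = 0\<close> leaves every subspace invariant, and any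
  non-trivial closed subspace will do. The orthogonal complement of a nonzero vector \<open>x\<close> is one
  (\<open>closed_orthogonal_complement\<close>): it misses \<open>x\<close>, and it is not zero because projecting along \<open>x\<close>
  would otherwise make the space one-dimensional (\<open>orthogonal_vector_exists\<close>).
\<close>

lemma cinner_diff_left:
  "cinner (x - y) z = cinner x z - cinner y (z::'h::complex_hilbert_space)"
  using cinner_add_left[of "x - y" y z] by simp

lemma cinner_scaleC_right:
  "cinner x (a *\<^sub>C y) = cnj a * cinner x (y::'h::complex_hilbert_space)"
  by (metis cinner_commute cinner_scaleC_left complex_cnj_mult)

lemma cinner_add_right:
  "cinner x (y + z) = cinner x y + cinner x (z::'h::complex_hilbert_space)"
  by (metis cinner_add_left cinner_commute complex_cnj_add)

lemma norm_add_square: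
  fixes x y :: "'h::complex_hilbert_space"
  shows "(norm (x + y))\<^sup>2 = (norm x)\<^sup>2 + (norm y)\<^sup>2 + 2 * Re (cinner x y)"
proof -
  have "(norm z)\<^sup>2 = Re (cinner z z)" for z :: 'h
    by (simp add: norm_eq_sqrt_cinner cinner_ge_zero)
  moreover have "Re (cinner y x) = Re (cinner x y)"
    using cinner_commute[of y x] by simp
  ultimately show ?thesis
    by (simp add: cinner_add_left cinner_add_right)
qed

text \<open>
  By the law of cosines, the real part of the inner product with \<open>x\<close>, and, with \<open>\<i> x\<close> in place of
  \<open>x\<close>, also its imaginary part are polynomials in norms. Orthogonality to \<open>x\<close> therefore
  amounts to two equations between continuous functions, namely Pythagoras' identity for \<open>x\<close> and
  for \<open>\<i> x\<close>.
\<close>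

lemma closed_orthogonal_complement:
  "closed {y. cinner y (x::'h::complex_hilbert_space) = 0}"
proof -
  have "cinner y x = 0 \<longleftrightarrow>
      (norm (y + x))\<^sup>2 = (norm y)\<^sup>2 + (norm x)\<^sup>2 \<and>
      (norm (y + \<i> *\<^sub>C x))\<^sup>2 = (norm y)\<^sup>2 + (norm (\<i> *\<^sub>C x))\<^sup>2" for y
    by (simp add: norm_add_square cinner_scaleC_right complex_eq_iff)
  then have "{y. cinner y x = 0} =
      {y. (norm (y + x))\<^sup>2 = (norm y)\<^sup>2 + (norm x)\<^sup>2} \<inter>
      {y. (norm (y + \<i> *\<^sub>C x))\<^sup>2 = (norm y)\<^sup>2 + (norm (\<i> *\<^sub>C x))\<^sup>2}"
    by blast
  then show ?thesis
    by (simp add: closed_Int closed_Collect_eq continuous_intros)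
qed

lemma csubspace_orthogonal_complement:
  "csubspace {y. cinner y (x::'h::complex_hilbert_space) = 0}"
  using cinner_diff_left[of 0 0 x]
  by (auto simp: complex_vector.subspace_def cinner_add_left cinner_scaleC_left)

text \<open>If only \<open>0\<close> is orthogonal to \<open>x\<close>, every vector equals its projection onto the line of \<open>x\<close>.\<close>

lemma orthogonal_vector_exists:
  fixes x :: "'h::complex_hilbert_space"
  assumes "\<not> cfinite_dimensional TYPE('h)" and "x \<noteq> 0"
  shows "\<exists>y. y \<noteq> 0 \<and> cinner y x = 0"
proof (rule ccontr)
  assume only_zero: "\<not> ?thesis"
  have "y \<in> cspan {x}" for y
  proof -
    let ?a = "cinner y x / cinner x x"
    have "cinner (y - ?a *\<^sub>C x) x = 0"
      using assms(2) by (simp add: cinner_diff_left cinner_scaleC_left cinner_eq_zero_iff)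
    then have "y = ?a *\<^sub>C x"
      using only_zero by (metis eq_iff_diff_eq_0)
    then show ?thesis
      by (metis complex_vector.span_base complex_vector.span_scale singletonI)
  qed
  then have "cspan {x} = UNIV" by blast
  then show False
    using assms(1) unfolding cfinite_dimensional_def by blast
qed

lemma exists_nonzero_vector:
  assumes "\<not> cfinite_dimensional TYPE('h::complex_hilbert_space)"
  shows "\<exists>x::'h. x \<noteq> 0"
proof (rule ccontr)
  assume "\<nexists>x::'h. x \<noteq> 0"
  then have "cspan ({}::'h set) = UNIV" by auto
  then show False
    using assms unfolding cfinite_dimensional_def by blast
qed

lemma nilpotent_kernel_nonzero:
  fixes T :: "'h::complex_hilbert_space \<Rightarrow> 'h" and x :: 'h
  assumes "bounded_linear T" and "nilpotent_operator T" and "x \<noteq> 0"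
  shows "\<exists>y. y \<noteq> 0 \<and> T y = 0"
proof (rule ccontr)
  assume "\<not> ?thesis"
  then have "inj T"
    using linear_injective_0[of T] assms(1) bounded_linear.linear by blast
  moreover obtain n where "T ^^ n = (\<lambda>x. 0)"
    using assms(2) unfolding nilpotent_operator_def by blast
  ultimately have "inj (\<lambda>x::'h. 0::'h)"
    using inj_fn[of T n] by simp
  then show False
    using assms(3) injD[of "\<lambda>_::'h. 0::'h" x 0] by blast
qed

lemma kernel_closed_invariant_csubspace:
  assumes "bounded_clinear T"
  shows "csubspace {x. T x = 0}" and "closed {x. T x = 0}" and "T ` {x. T x = 0} \<subseteq> {x. T x = 0}"
proof -
  interpret L: Vector_Spaces.linear scaleC scaleC T
    using assms unfolding bounded_clinear_def by simp
  show "csubspace {x. T x = 0}"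
    by (simp add: complex_vector.subspace_def L.add L.scale L.zero)
  have "continuous_on UNIV T"
    using assms unfolding bounded_clinear_def by (simp add: linear_continuous_on)
  then show "closed {x. T x = 0}"
    by (simp add: closed_Collect_eq)
  show "T ` {x. T x = 0} \<subseteq> {x. T x = 0}"
    by auto
qed

theorem corollary2p5:
  fixes T :: "'h::complex_hilbert_space \<Rightarrow> 'h"
  assumes "separable_space (euclidean :: 'h topology)"
    and "\<not> cfinite_dimensional TYPE('h)"
    and "bounded_clinear T"
    and "nilpotent_operator T"
  shows "\<exists>M. nontrivial_invariant_subspace T M"
proof -
  obtain x :: 'h where x: "x \<noteq> 0"
    using exists_nonzero_vector assms(2) by blast
  show ?thesis
  proof (cases "\<forall>y. T y = 0")
    case True
    let ?M = "{y. cinner y x = 0}"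
    have "0 \<in> ?M"
      using cinner_diff_left[of 0 0 x] by simp
    moreover have "?M \<noteq> {0}"
      using orthogonal_vector_exists[OF assms(2) x] by blast
    moreover have "x \<notin> ?M"
      using x by (simp add: cinner_eq_zero_iff)
    ultimately have "nontrivial_invariant_subspace T ?M"
      using True csubspace_orthogonal_complement[of x] closed_orthogonal_complement[of x]
      unfolding nontrivial_invariant_subspace_def by auto
    then show ?thesis by blast
  next
    case False
    have "bounded_linear T"
      using assms(3) unfolding bounded_clinear_def by simp
    then have "{y. T y = 0} \<noteq> {0}"
      using nilpotent_kernel_nonzero[OF _ assms(4) x] by blast
    then have "nontrivial_invariant_subspace T {y. T y = 0}"
      using False kernel_closed_invariant_csubspace[OF assms(3)]
      unfolding nontrivial_invariant_subspace_def by blast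
    then show ?thesis by blast
  qed
qed

end
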